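(* Let $n\ge3$ be an odd integer and let $x_0\in[-\tfrac14,\tfrac14]+\mathbb{Z}$. Then there exists $\lambda>0$ such that $Z_\lambda h_n(x_0,0)=0$ and therefore $$Z_\lambda h_n(\pm x_0+k,\ell)=0\quad\text{for all }k,\ell\in\mathbb{Z}.$$
   Context: For $n\in\mathbb{Z}_{\ge 0}$ the Hermite function is $h_n(x) = (-1)^n c_n^{-1/2} e^{\pi x^2}\frac{d^n}{dx^n}e^{-2\pi x^2}$, $x\in\mathbb{R}$, with $c_n=(2\pi)^n 2^{n-1/2} n!$. For $\lambda>0$ the Zak transform is $Z_\lambda f(x,\gamma)=\sqrt{\lambda}\sum_{k\in\mathbb{Z}}f(\lambda(x+k))e^{-2\pi i k\gamma}$, $x,\gamma\in\mathbb{R}$. *)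

theory Defs
  imports "HOL-Analysis.Analysis" "HOL-Library.Set_Algebras"
begin

definition hermite_const :: "nat \<Rightarrow> real" where
  "hermite_const n = (2 * pi) ^ n * 2 powr (real n - 1 / 2) * fact n"

definition hermite_fun :: "nat \<Rightarrow> real \<Rightarrow> real" where
  "hermite_fun n x =
     (- 1) ^ n * hermite_const n powr (- 1 / 2) * exp (pi * x\<^sup>2) *
     (deriv ^^ n) (\<lambda>t. exp (- 2 * pi * t\<^sup>2)) x"

text \<open>The \<^const>\<open>infsum\<close> below is \<open>0\<close> by convention when the family is not summable. For the
  Hermite functions and \<open>lam > 0\<close> this never happens: they are polynomials times
  \<open>exp (- pi * x\<^sup>2)\<close>, so the series converges absolutely.\<close>

definition zak :: "real \<Rightarrow> (real \<Rightarrow> complex) \<Rightarrow> real \<Rightarrow> real \<Rightarrow> complex" where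
  "zak lam f x \<gamma> =
     of_real (sqrt lam) *
     (\<Sum>\<^sub>\<infinity>k::int. f (lam * (x + of_int k)) * exp (- 2 * pi * \<i> * of_int k * of_real \<gamma>))"

end

theory Submission
  imports Defs
begin

text \<open>
  After the substitution \<open>\<mu> = sqrt (2 * pi) * lam\<close>, and up to a constant factor, the Zak transform
  at an integer frequency is the lattice sum \<open>F \<mu> = (\<Sum>k. g (\<mu> * (u + k)))\<close> over the integers,
  where \<open>g y = H\<^sub>n y * exp (- y\<^sup>2 / 2)\<close> with the Hermite polynomial \<open>H\<^sub>n\<close>. Periodicity in \<open>u\<close> and
  oddness of \<open>g\<close> reduce everything to one zero of \<open>F\<close> for a fixed \<open>u\<close> between \<open>0\<close> and \<open>1/4\<close>; for
  \<open>u = 0\<close> every \<open>\<mu>\<close> works. For \<open>u > 0\<close> the zero comes from the intermediate value theorem.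

  By oddness the sum over the integers is a difference of two sums over rays,
  \<open>F \<mu> = (\<Sum>j\<ge>0. g (\<mu> * (u + j))) - (\<Sum>j\<ge>0. g (\<mu> * (1 - u + j)))\<close>. Its arguments in increasing order
  are \<open>\<mu> * u\<close>, \<open>\<mu> * (1 - u)\<close>, \<open>\<mu> * (1 + u)\<close>, \<open>\<mu> * (2 - u)\<close> and so on, with alternating signs. Let
  \<open>a\<close> be the largest zero of \<open>H\<^sub>n\<close> and suppose that \<open>g\<close> decreases on \<open>[3 * a, \<infinity>)\<close>.
  For \<open>\<mu> = 3 * a / u\<close> all arguments lie in that interval, so pairing neighbours gives
  \<open>F \<mu> \<ge> 0\<close>. For \<open>\<mu> = a / u\<close> the first term vanishes, and since \<open>u \<le> 1/4\<close> gives \<open>1 - u \<ge> 3 * u\<close>,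
  all remaining arguments lie in the interval; pairing them, now starting with a negative term,
  gives \<open>F \<mu> \<le> 0\<close>. This is lemma \<open>lattice_sum_has_zero\<close>.

  It remains to see that \<open>g\<close> decreases on \<open>[3 * a, \<infinity>)\<close> (lemma \<open>hermite_gauss_root_antimono\<close>).
  The three-term recurrence yields both ingredients: \<open>g\<close> decreases where \<open>y\<^sup>2 \<ge> 2 * n\<close>,
  and the largest zero satisfies \<open>a\<^sup>2 \<ge> (n - 1) / 2\<close>. Since \<open>9 * (n - 1) / 2 \<ge> 2 * n\<close>
  for \<open>n \<ge> 3\<close>, the two fit together.
\<close>

section \<open>Hermite polynomials\<close>

fun hermite_poly :: "nat \<Rightarrow> real \<Rightarrow> real" where
  "hermite_poly 0 y = 1"
| "hermite_poly (Suc 0) y = 2 * y"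
| "hermite_poly (Suc (Suc n)) y =
     2 * y * hermite_poly (Suc n) y - 2 * real (Suc n) * hermite_poly n y"

text \<open>The truncated index \<open>n - 1\<close> is harmless at \<open>n = 0\<close>, where its coefficient vanishes; this avoids a
  case distinction between the first step of the recurrence and the later ones.\<close>

lemma hermite_poly_Suc:
  "hermite_poly (Suc n) y = 2 * y * hermite_poly n y - 2 * real n * hermite_poly (n - 1) y"
  by (cases n) auto

lemma hermite_poly_has_derivative:
  "(hermite_poly n has_real_derivative 2 * real n * hermite_poly (n - 1) y) (at y)"
proof (induction n y rule: hermite_poly.induct)
  case (1 y)
  then show ?case by simp
next
  case (2 y)
  have "((\<lambda>y. 2 * y) has_real_derivative 2) (at y)"
    by (auto intro!: derivative_eq_intros)
  then show ?case by simp
next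
  case (3 n y)
  have "((\<lambda>y. 2 * y * hermite_poly (Suc n) y - 2 * real (Suc n) * hermite_poly n y)
      has_real_derivative
        2 * hermite_poly (Suc n) y + 2 * y * (2 * real (Suc n) * hermite_poly n y)
        - 2 * real (Suc n) * (2 * real n * hermite_poly (n - 1) y)) (at y)"
    using 3 by (auto intro!: derivative_eq_intros)
  also have "2 * hermite_poly (Suc n) y + 2 * y * (2 * real (Suc n) * hermite_poly n y)
        - 2 * real (Suc n) * (2 * real n * hermite_poly (n - 1) y)
      = 2 * hermite_poly (Suc n) y + 2 * real (Suc n) * hermite_poly (Suc n) y"
    unfolding hermite_poly_Suc[of n y] by (simp add: algebra_simps)
  also have "\<dots> = 2 * real (Suc (Suc n)) * hermite_poly (Suc (Suc n) - 1) y"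
    by (simp add: algebra_simps)
  finally show ?case by simp
qed

lemma continuous_on_hermite_poly: "continuous_on S (hermite_poly n)"
  by (meson DERIV_isCont continuous_at_imp_continuous_on hermite_poly_has_derivative)

lemma hermite_poly_minus: "hermite_poly n (- y) = (- 1) ^ n * hermite_poly n y"
  by (induction n y rule: hermite_poly.induct) (auto simp: algebra_simps)

text \<open>A crude bound suffices: the Gaussian factor beats every exponential.\<close>

lemma hermite_poly_growth:
  "\<exists>C. \<forall>y. \<bar>hermite_poly n y\<bar> \<le> C * exp (real n * \<bar>y\<bar>)"
proof (induction n rule: induct_nat_012)
  case 0
  show ?case by (intro exI[of _ 1]) auto
next
  case 1
  have "\<bar>y\<bar> \<le> exp \<bar>y\<bar>" for y :: real
    using exp_ge_add_one_self[of "\<bar>y\<bar>"] by linarith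
  then show ?case by (intro exI[of _ 2]) (auto simp: abs_mult)
next
  case (ge2 n)
  then obtain C D where
    C: "\<And>y. \<bar>hermite_poly n y\<bar> \<le> C * exp (real n * \<bar>y\<bar>)" and
    D: "\<And>y. \<bar>hermite_poly (Suc n) y\<bar> \<le> D * exp (real (Suc n) * \<bar>y\<bar>)"
    by blast
  have C0: "0 \<le> C" and D0: "0 \<le> D"
    using order_trans[OF abs_ge_zero C[of 0]] order_trans[OF abs_ge_zero D[of 0]] by auto
  have "\<bar>hermite_poly (Suc (Suc n)) y\<bar>
      \<le> (2 * D + 2 * real (Suc n) * C) * exp (real (Suc (Suc n)) * \<bar>y\<bar>)" for y
  proof -
    have y: "\<bar>y\<bar> \<le> exp \<bar>y\<bar>"
      using exp_ge_add_one_self[of "\<bar>y\<bar>"] by linarith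
    have "\<bar>y\<bar> * \<bar>hermite_poly (Suc n) y\<bar> \<le> exp \<bar>y\<bar> * (D * exp (real (Suc n) * \<bar>y\<bar>))"
      by (intro mult_mono y D) auto
    also have "\<dots> = D * exp (real (Suc (Suc n)) * \<bar>y\<bar>)"
      by (simp add: algebra_simps flip: exp_add)
    finally have 1: "\<bar>y\<bar> * \<bar>hermite_poly (Suc n) y\<bar> \<le> D * exp (real (Suc (Suc n)) * \<bar>y\<bar>)" .
    have 2: "\<bar>hermite_poly n y\<bar> \<le> C * exp (real (Suc (Suc n)) * \<bar>y\<bar>)"
      by (rule order_trans[OF C]) (auto intro!: mult_left_mono mult_right_mono C0)
    have "\<bar>hermite_poly (Suc (Suc n)) y\<bar>
        \<le> 2 * (\<bar>y\<bar> * \<bar>hermite_poly (Suc n) y\<bar>) + 2 * real (Suc n) * \<bar>hermite_poly n y\<bar>"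
      by (simp only: hermite_poly.simps) (rule order_trans[OF abs_triangle_ineq4], simp add: abs_mult)
    also have "\<dots> \<le> 2 * (D * exp (real (Suc (Suc n)) * \<bar>y\<bar>))
        + 2 * real (Suc n) * (C * exp (real (Suc (Suc n)) * \<bar>y\<bar>))"
      by (intro add_mono mult_left_mono 1 2) auto
    finally show ?thesis by (simp add: algebra_simps)
  qed
  then show ?case by blast
qed

text \<open>The ratios \<open>r\<^sub>k = H\<^sub>k / H\<^sub>k\<^sub>-\<^sub>1\<close> obey \<open>r\<^sub>k\<^sub>+\<^sub>1 = 2 * y - 2 * k / r\<^sub>k\<close>. If \<open>r\<^sub>k \<ge> y\<close> and \<open>2 * k \<le> y\<^sup>2\<close>,
  then \<open>r\<^sub>k\<^sub>+\<^sub>1 \<ge> 2 * y - y = y\<close>, so the bound propagates. The indices \<open>k\<close> used on the way to \<open>n\<close> are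
  at most \<open>n - 1\<close>, which explains the hypothesis on \<open>n\<close>.\<close>

lemma hermite_poly_ratio_ge:
  assumes "0 < y" and "2 * real n \<le> y\<^sup>2 + 2" and "0 < n"
  shows "0 < hermite_poly (n - 1) y \<and> y * hermite_poly (n - 1) y \<le> hermite_poly n y"
  using assms(2,3)
proof (induction n)
  case 0
  then show ?case by simp
next
  case (Suc n)
  show ?case
  proof (cases "n = 0")
    case True
    then show ?thesis using \<open>0 < y\<close> by simp
  next
    case False
    with Suc have IH: "0 < hermite_poly (n - 1) y" "y * hermite_poly (n - 1) y \<le> hermite_poly n y"
      by auto
    have pos: "0 < hermite_poly n y"
      using IH \<open>0 < y\<close> by (smt (verit) mult_pos_pos)
    have "2 * real n * hermite_poly (n - 1) y \<le> y\<^sup>2 * hermite_poly (n - 1) y"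
      using Suc.prems IH by (intro mult_right_mono) auto
    also have "\<dots> \<le> y * hermite_poly n y"
      using IH(2) \<open>0 < y\<close> by (simp add: power2_eq_square mult.assoc)
    finally show ?thesis
      using pos by (simp add: hermite_poly_Suc[of n])
  qed
qed

text \<open>Largest zeros increase with the degree. At the largest zero \<open>z\<close> of \<open>H\<^sub>n\<close> the recurrence gives
  \<open>H\<^sub>n\<^sub>+\<^sub>1 z = - 2 * n * H\<^sub>n\<^sub>-\<^sub>1 z \<le> 0\<close>, so \<open>H\<^sub>n\<^sub>+\<^sub>1\<close> has a zero at or beyond \<open>z\<close>; its derivative is a
  positive multiple of \<open>H\<^sub>n\<close> there, so it is positive beyond that zero. Positivity of all
  lower degrees beyond \<open>z\<close> is carried along, as it is what the induction and the lower bound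
  for \<open>z\<close> use.\<close>

lemma hermite_poly_last_root:
  assumes "0 < n"
  shows "\<exists>z\<ge>0. hermite_poly n z = 0 \<and> (\<forall>k\<le>n. \<forall>y>z. 0 < hermite_poly k y)"
  using assms
proof (induction n)
  case 0
  then show ?case by simp
next
  case (Suc n)
  show ?case
  proof (cases "n = 0")
    case True
    then show ?thesis by (intro exI[of _ 0]) (auto simp: le_Suc_eq)
  next
    case False
    with Suc obtain z where z: "0 \<le> z" "hermite_poly n z = 0"
      and pos: "\<And>k y. k \<le> n \<Longrightarrow> z < y \<Longrightarrow> 0 < hermite_poly k y"
      by auto
    have "0 \<le> hermite_poly (n - 1) z"
    proof (rule tendsto_lowerbound)
      show "(hermite_poly (n - 1) \<longlongrightarrow> hermite_poly (n - 1) z) (at_right z)"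
        using DERIV_isCont[OF hermite_poly_has_derivative]
        by (metis filterlim_at_split isCont_def)
      show "\<forall>\<^sub>F y in at_right z. 0 \<le> hermite_poly (n - 1) y"
        using pos[of "n - 1"] by (auto simp: eventually_at_right_field intro!: exI[of _ "z + 1"] less_imp_le)
    qed simp
    then have low: "hermite_poly (Suc n) z \<le> 0"
      by (simp add: hermite_poly_Suc[of n] z(2))
    \<comment> \<open>Any point with \<open>b \<ge> 1\<close> and \<open>b \<ge> 2 * (n + 1)\<close> lies in the range of the ratio bound.\<close>
    define b where "b = z + 2 * real (Suc n)"
    have b: "z \<le> b" "0 < b" "1 \<le> b" using z(1) by (auto simp: b_def)
    have "2 * real (Suc n) \<le> b" using z(1) by (simp add: b_def)
    also have "b \<le> b\<^sup>2" using b by (simp add: power2_eq_square)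
    finally have "0 < hermite_poly n b \<and> b * hermite_poly n b \<le> hermite_poly (Suc n) b"
      using hermite_poly_ratio_ge[of b "Suc n"] b by simp
    then have high: "0 \<le> hermite_poly (Suc n) b"
      using b by (smt (verit) mult_pos_pos)
    obtain w where w: "z \<le> w" "hermite_poly (Suc n) w = 0"
      using IVT'[of "hermite_poly (Suc n)" z 0 b] low high b continuous_on_hermite_poly by blast
    have "0 < hermite_poly (Suc n) y" if "w < y" for y
    proof -
      have "hermite_poly (Suc n) w < hermite_poly (Suc n) y"
      proof (rule DERIV_pos_imp_increasing_open[OF that])
        fix x assume "w < x" "x < y"
        then have "0 < 2 * real (Suc n) * hermite_poly (Suc n - 1) x"
          using pos[of n x] w(1) by simp
        then show "\<exists>d. (hermite_poly (Suc n) has_real_derivative d) (at x) \<and> 0 < d"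
          using hermite_poly_has_derivative by blast
      qed (rule continuous_on_hermite_poly)
      then show ?thesis using w by simp
    qed
    then have "\<forall>k\<le>Suc n. \<forall>y>w. 0 < hermite_poly k y"
      using pos w(1) by (auto simp: le_Suc_eq)
    then show ?thesis using w z(1) by (intro exI[of _ w]) auto
  qed
qed

text \<open>Where \<open>H\<^sub>0, \<dots>, H\<^sub>n\<close> are all positive, the recurrence gives \<open>H\<^sub>n\<^sub>-\<^sub>1 \<le> 2 * y * H\<^sub>n\<^sub>-\<^sub>2\<close> on dropping its
  subtracted term, and \<open>2 * (n - 1) * H\<^sub>n\<^sub>-\<^sub>2 < 2 * y * H\<^sub>n\<^sub>-\<^sub>1\<close> because \<open>H\<^sub>n > 0\<close>. Together they force
  \<open>2 * (n - 1) < 4 * y\<^sup>2\<close>, and \<open>y\<close> may tend to \<open>z\<close>.\<close>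

lemma hermite_poly_last_root_ge:
  assumes "2 \<le> n" and "0 \<le> z" and pos: "\<And>k y. k \<le> n \<Longrightarrow> z < y \<Longrightarrow> 0 < hermite_poly k y"
  shows "real n - 1 \<le> 2 * z\<^sup>2"
proof (rule tendsto_lowerbound)
  obtain m where m: "n = Suc (Suc m)"
    using assms(1) by (metis Suc_diff_le numeral_2_eq_2 add_2_eq_Suc le_Suc_ex)
  have "real n - 1 \<le> 2 * y\<^sup>2" if y: "z < y" for y
  proof -
    have y0: "0 < y" using y assms(2) by simp
    have p: "0 < hermite_poly m y" "0 < hermite_poly n y" "0 \<le> real m * hermite_poly (m - 1) y"
      using pos[of m y] pos[of n y] pos[of "m - 1" y] y
      by (simp_all add: m zero_le_mult_iff less_imp_le le_diff_conv)
    have "hermite_poly (Suc m) y \<le> 2 * y * hermite_poly m y"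
      using p(3) by (simp add: hermite_poly_Suc[of m])
    then have "2 * y * hermite_poly (Suc m) y \<le> 2 * y * (2 * y * hermite_poly m y)"
      using y0 by (intro mult_left_mono) auto
    then have "2 * real (Suc m) * hermite_poly m y \<le> 4 * y\<^sup>2 * hermite_poly m y"
      using p(2) by (simp add: m power2_eq_square algebra_simps)
    then show ?thesis using p(1) by (simp add: m)
  qed
  then show "\<forall>\<^sub>F y in at_right z. real n - 1 \<le> 2 * y\<^sup>2"
    by (auto simp: eventually_at_right_field intro!: exI[of _ "z + 1"])
  show "((\<lambda>y. 2 * y\<^sup>2) \<longlongrightarrow> 2 * z\<^sup>2) (at_right z)"
    by (intro tendsto_intros)
qed simp

section \<open>Hermite functions\<close>

text \<open>The Hermite function of degree \<open>n\<close> in the normalisation attached to the weight \<open>exp (- y\<^sup>2)\<close>;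
  the functions of the theorem are constant multiples of its dilation by \<open>sqrt (2 * pi)\<close>.\<close>

definition hermite_gauss :: "nat \<Rightarrow> real \<Rightarrow> real" where
  "hermite_gauss n y = hermite_poly n y * exp (- y\<^sup>2 / 2)"

lemma hermite_gauss_minus: "odd n \<Longrightarrow> hermite_gauss n (- y) = - hermite_gauss n y"
  by (simp add: hermite_gauss_def hermite_poly_minus)

lemma continuous_on_hermite_gauss: "continuous_on S (hermite_gauss n)"
  unfolding hermite_gauss_def by (intro continuous_intros continuous_on_hermite_poly) auto

text \<open>Completing the square: \<open>(n + 1) * \<bar>y\<bar> \<le> ((n + 1)\<^sup>2 + y\<^sup>2) / 2\<close>.\<close>

lemma hermite_gauss_exponential_decay: "\<exists>C. \<forall>y. \<bar>hermite_gauss n y\<bar> \<le> C * exp (- \<bar>y\<bar>)"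
proof -
  obtain C where C: "\<And>y. \<bar>hermite_poly n y\<bar> \<le> C * exp (real n * \<bar>y\<bar>)"
    using hermite_poly_growth by blast
  have C0: "0 \<le> C" using order_trans[OF abs_ge_zero C[of 0]] by simp
  have "\<bar>hermite_gauss n y\<bar> \<le> C * exp ((real n + 1)\<^sup>2 / 2) * exp (- \<bar>y\<bar>)" for y
  proof -
    have "0 \<le> (\<bar>y\<bar> - (real n + 1))\<^sup>2" by simp
    then have "real n * \<bar>y\<bar> + - y\<^sup>2 / 2 \<le> (real n + 1)\<^sup>2 / 2 + - \<bar>y\<bar>"
      by (simp add: power2_diff field_simps)
    then have "exp (real n * \<bar>y\<bar>) * exp (- y\<^sup>2 / 2) \<le> exp ((real n + 1)\<^sup>2 / 2) * exp (- \<bar>y\<bar>)"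
      by (simp flip: exp_add)
    then have "C * (exp (real n * \<bar>y\<bar>) * exp (- y\<^sup>2 / 2))
        \<le> C * (exp ((real n + 1)\<^sup>2 / 2) * exp (- \<bar>y\<bar>))"
      using C0 by (intro mult_left_mono)
    moreover have "\<bar>hermite_gauss n y\<bar> \<le> C * exp (real n * \<bar>y\<bar>) * exp (- y\<^sup>2 / 2)"
      unfolding hermite_gauss_def abs_mult by (simp add: C mult_right_mono)
    ultimately show ?thesis by (simp add: mult.assoc)
  qed
  then show ?thesis by blast
qed

text \<open>The derivative has the sign of \<open>2 * n * H\<^sub>n\<^sub>-\<^sub>1 y - y * H\<^sub>n y\<close>, and the ratio bound gives
  \<open>y * H\<^sub>n y \<ge> y\<^sup>2 * H\<^sub>n\<^sub>-\<^sub>1 y \<ge> 2 * n * H\<^sub>n\<^sub>-\<^sub>1 y\<close>.\<close>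

lemma hermite_gauss_antimono:
  assumes "0 < n" and "0 < s" and "2 * real n \<le> s\<^sup>2" and "s \<le> t"
  shows "hermite_gauss n t \<le> hermite_gauss n s"
proof (rule DERIV_nonpos_imp_nonincreasing[OF \<open>s \<le> t\<close>])
  fix y assume "s \<le> y" "y \<le> t"
  then have y: "0 < y" "2 * real n \<le> y\<^sup>2"
    using assms(2,3) power_mono[of s y 2] by linarith+
  let ?d = "(2 * real n * hermite_poly (n - 1) y - y * hermite_poly n y) * exp (- y\<^sup>2 / 2)"
  have "(hermite_gauss n has_real_derivative ?d) (at y)"
    unfolding hermite_gauss_def[abs_def]
    by (auto intro!: derivative_eq_intros hermite_poly_has_derivative simp: algebra_simps)
  moreover have "?d \<le> 0"
  proof -
    have *: "0 < hermite_poly (n - 1) y" "y * hermite_poly (n - 1) y \<le> hermite_poly n y"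
      using hermite_poly_ratio_ge[of y n] y assms(1) by auto
    have "2 * real n * hermite_poly (n - 1) y \<le> y\<^sup>2 * hermite_poly (n - 1) y"
      using * y by (intro mult_right_mono) auto
    also have "\<dots> \<le> y * hermite_poly n y"
      using * y by (simp add: power2_eq_square mult.assoc)
    finally show ?thesis by (simp add: mult_le_0_iff)
  qed
  ultimately show "\<exists>d. (hermite_gauss n has_real_derivative d) (at y) \<and> d \<le> 0" by blast
qed

text \<open>Take the largest zero \<open>a\<close>. From \<open>a\<^sup>2 \<ge> (n - 1) / 2\<close> one gets \<open>(3 * a)\<^sup>2 \<ge> 9 * (n - 1) / 2 \<ge> 2 * n\<close>,
  the last step being \<open>5 * n \<ge> 9\<close>. The same bound shows \<open>a > 0\<close>.\<close>

lemma hermite_gauss_root_antimono: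
  assumes "3 \<le> n"
  shows "\<exists>a>0. hermite_gauss n a = 0 \<and>
    (\<forall>s t. 3 * a \<le> s \<longrightarrow> s \<le> t \<longrightarrow> hermite_gauss n t \<le> hermite_gauss n s)"
proof -
  obtain a where a: "0 \<le> a" "hermite_poly n a = 0"
    and pos: "\<And>k y. k \<le> n \<Longrightarrow> a < y \<Longrightarrow> 0 < hermite_poly k y"
    using hermite_poly_last_root[of n] assms by auto
  have a2: "real n - 1 \<le> 2 * a\<^sup>2"
    using hermite_poly_last_root_ge[of n a] a pos assms by auto
  with assms have "a \<noteq> 0" by (intro notI) simp
  with a have a0: "0 < a" by simp
  have "hermite_gauss n t \<le> hermite_gauss n s" if "3 * a \<le> s" "s \<le> t" for s t
  proof (rule hermite_gauss_antimono[OF _ _ _ \<open>s \<le> t\<close>])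
    have "(3 * a)\<^sup>2 \<le> s\<^sup>2" using that a0 by (intro power_mono) auto
    then show "2 * real n \<le> s\<^sup>2"
      using a2 assms by (simp add: power_mult_distrib)
  qed (use that a0 assms in auto)
  then show ?thesis using a0 a(2) by (auto simp: hermite_gauss_def)
qed

text \<open>Rodrigues' formula, with the dilation built in so that the Gaussian \<open>exp (- 2 * pi * t\<^sup>2)\<close> is the
  case \<open>s = sqrt (2 * pi)\<close>.\<close>

lemma deriv_iter_gaussian:
  "(deriv ^^ n) (\<lambda>t. exp (- (s * t)\<^sup>2)) =
     (\<lambda>x. (- s) ^ n * hermite_poly n (s * x) * exp (- (s * x)\<^sup>2))"
proof (induction n)
  case 0
  show ?case by simp
next
  case (Suc n)
  have "((\<lambda>x. (- s) ^ n * hermite_poly n (s * x) * exp (- (s * x)\<^sup>2)) has_real_derivative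
      (- s) ^ Suc n * hermite_poly (Suc n) (s * x) * exp (- (s * x)\<^sup>2)) (at x)" for x
  proof -
    have "((\<lambda>x. hermite_poly n (s * x)) has_real_derivative
        2 * real n * hermite_poly (n - 1) (s * x) * s) (at x)"
      by (rule DERIV_chain2[OF hermite_poly_has_derivative]) (auto intro!: derivative_eq_intros)
    then show ?thesis
      by (auto intro!: derivative_eq_intros simp: hermite_poly_Suc algebra_simps power2_eq_square)
  qed
  then show ?case
    using Suc by (auto intro!: ext DERIV_imp_deriv)
qed

lemma hermite_fun_eq_hermite_gauss:
  "hermite_fun n x =
     hermite_const n powr (- 1 / 2) * sqrt (2 * pi) ^ n * hermite_gauss n (sqrt (2 * pi) * x)"
proof -
  let ?s = "sqrt (2 * pi)"
  have g: "(\<lambda>t. exp (- 2 * pi * t\<^sup>2)) = (\<lambda>t. exp (- (?s * t)\<^sup>2))"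
    by (simp add: power_mult_distrib)
  have e: "exp (pi * x\<^sup>2) * exp (- (?s * x)\<^sup>2) = exp (- (?s * x)\<^sup>2 / 2)"
    by (simp add: power_mult_distrib flip: exp_add)
  have "hermite_fun n x = (- 1) ^ n * (- ?s) ^ n * hermite_const n powr (- 1 / 2)
      * hermite_poly n (?s * x) * (exp (pi * x\<^sup>2) * exp (- (?s * x)\<^sup>2))"
    unfolding hermite_fun_def g deriv_iter_gaussian by (simp add: ac_simps)
  also have "(- 1) ^ n * (- ?s) ^ n = ?s ^ n"
    by (simp flip: power_mult_distrib)
  finally show ?thesis unfolding e hermite_gauss_def by (simp add: ac_simps)
qed

section \<open>Sums over translated lattices\<close>

definition lattice_sum :: "(real \<Rightarrow> real) \<Rightarrow> real \<Rightarrow> real \<Rightarrow> real" where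
  "lattice_sum g \<mu> x = (\<Sum>\<^sub>\<infinity>k::int. g (\<mu> * (x + of_int k)))"

text \<open>Translation by an integer and, below, reflection are reindexings of the integers, so neither
  calls for summability of the family.\<close>

lemma lattice_sum_shift: "lattice_sum g \<mu> (x + of_int m) = lattice_sum g \<mu> x"
  unfolding lattice_sum_def
  by (rule infsum_reindex_bij_witness[where i = "\<lambda>k. k - m" and j = "\<lambda>k. k + m"])
     (auto simp: algebra_simps)

lemma lattice_sum_minus:
  assumes "\<And>y. g (- y) = - g y"
  shows "lattice_sum g \<mu> (- x) = - lattice_sum g \<mu> x"
proof -
  have "lattice_sum g \<mu> (- x) = (\<Sum>\<^sub>\<infinity>k::int. - g (\<mu> * (x + of_int k)))"
    unfolding lattice_sum_def
  proof (rule infsum_reindex_bij_witness[where i = uminus and j = uminus])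
    fix k :: int
    have "\<mu> * (- x + of_int k) = - (\<mu> * (x + of_int (- k)))" by (simp add: algebra_simps)
    then show "- g (\<mu> * (x + of_int (- k))) = g (\<mu> * (- x + of_int k))"
      by (simp only: assms minus_minus)
  qed auto
  then show ?thesis by (simp add: lattice_sum_def infsum_uminus)
qed

text \<open>The geometric majorant depends only on the lower bound \<open>r\<close> for \<open>\<mu>\<close>. Thus it gives summability
  and also, by the Weierstrass test, continuity in \<open>\<mu>\<close>.\<close>

lemma ray_term_bound:
  assumes decay: "\<And>y. \<bar>g y\<bar> \<le> C * exp (- \<bar>y\<bar>)" and "0 < r" and "r \<le> \<mu>" and "0 \<le> c"
  shows "norm (g (\<mu> * (c + real j)) :: real) \<le> C * exp (- r) ^ j"
proof -
  have C0: "0 \<le> C" using order_trans[OF abs_ge_zero decay[of 0]] by simp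
  have "real j * r \<le> (c + real j) * \<mu>"
    using assms by (intro mult_mono) auto
  then have "exp (- \<bar>\<mu> * (c + real j)\<bar>) \<le> exp (real j * - r)"
    by (simp add: mult.commute)
  then show ?thesis
    using order_trans[OF decay mult_left_mono[OF _ C0]]
    by (simp only: real_norm_def exp_of_nat_mult)
qed

lemma ray_bound_summable: "0 < r \<Longrightarrow> summable (\<lambda>j. C * exp (- r) ^ j :: real)"
  by (intro summable_mult summable_geometric) auto

lemma ray_summable:
  assumes "\<And>y. \<bar>g y\<bar> \<le> C * exp (- \<bar>y\<bar>)" and "0 < \<mu>" and "0 \<le> c"
  shows "summable (\<lambda>j. norm (g (\<mu> * (c + real j)) :: real))"
  using ray_term_bound[OF assms(1,2) order_refl assms(3)]
  by (intro summable_comparison_test[OF _ ray_bound_summable[OF assms(2)]]) auto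

lemma ray_sum_continuous:
  fixes g :: "real \<Rightarrow> real"
  assumes cont: "continuous_on UNIV g"
    and decay: "\<And>y. \<bar>g y\<bar> \<le> C * exp (- \<bar>y\<bar>)" and "0 < r" and "0 \<le> c"
  shows "continuous_on {r..R} (\<lambda>\<mu>. \<Sum>j. g (\<mu> * (c + real j)))"
proof (rule uniform_limit_theorem)
  show "uniform_limit {r..R} (\<lambda>n \<mu>. \<Sum>j<n. g (\<mu> * (c + real j)))
          (\<lambda>\<mu>. \<Sum>j. g (\<mu> * (c + real j))) sequentially"
    using ray_term_bound[OF decay \<open>0 < r\<close> _ \<open>0 \<le> c\<close>]
    by (intro Weierstrass_m_test[OF _ ray_bound_summable[OF \<open>0 < r\<close>]]) auto
  show "\<forall>\<^sub>F n in sequentially. continuous_on {r..R} (\<lambda>\<mu>. \<Sum>j<n. g (\<mu> * (c + real j)))"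
    by (intro always_eventually allI continuous_intros continuous_on_compose2[OF cont]) auto
qed simp

text \<open>The terms with \<open>k \<ge> 0\<close> form the first ray. For \<open>k = - 1 - j\<close> the argument is
  \<open>- \<mu> * (1 - u + j)\<close>, and oddness turns these terms into the second ray with a minus sign.\<close>

lemma lattice_sum_eq_ray_sums:
  assumes odd: "\<And>y. g (- y) = - g y"
    and decay: "\<And>y. \<bar>g y\<bar> \<le> C * exp (- \<bar>y\<bar>)" and \<mu>: "0 < \<mu>" and u: "0 \<le> u" "u \<le> 1"
  shows "lattice_sum g \<mu> u = (\<Sum>j. g (\<mu> * (u + real j))) - (\<Sum>j. g (\<mu> * (1 - u + real j)))"
proof -
  let ?f = "\<lambda>k::int. g (\<mu> * (u + of_int k))"
  let ?A = "\<Sum>j. g (\<mu> * (u + real j))" and ?B = "\<Sum>j. g (\<mu> * (1 - u + real j))"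
  let ?neg = "\<lambda>j. - 1 - int j"
  have half: "((\<lambda>j. g (\<mu> * (c + real j))) has_sum (\<Sum>j. g (\<mu> * (c + real j)))) UNIV"
    if "0 \<le> c" for c
    using ray_summable[OF decay \<mu> that]
    by (intro norm_summable_imp_has_sum summable_sums) (auto intro: summable_norm_cancel)
  have 1: "(?f has_sum ?A) (range int)"
    using half[of u] u by (subst has_sum_reindex) (auto simp: o_def)
  have "\<mu> * (u + of_int (?neg j)) = - (\<mu> * (1 - u + real j))" for j
    by (simp add: algebra_simps)
  then have "?f (?neg j) = - g (\<mu> * (1 - u + real j))" for j
    by (simp only: odd)
  moreover have "((\<lambda>j. - g (\<mu> * (1 - u + real j))) has_sum - ?B) UNIV"
    using half[of "1 - u"] u by (simp add: has_sum_uminus)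
  ultimately have 2: "(?f has_sum - ?B) (range ?neg)"
    by (subst has_sum_reindex) (auto simp: o_def inj_on_def)
  have "(?f has_sum (?A + - ?B)) (range int \<union> range ?neg)"
    by (rule has_sum_Un_disjoint[OF 1 2]) auto
  also have "range int \<union> range ?neg = UNIV"
  proof -
    have "k \<in> range int \<union> range ?neg" for k
    proof (cases "0 \<le> k")
      case True
      then have "k = int (nat k)" by simp
      then show ?thesis by blast
    next
      case False
      then have "k = ?neg (nat (- 1 - k))" by simp
      then show ?thesis by blast
    qed
    then show ?thesis by blast
  qed
  finally show ?thesis unfolding lattice_sum_def by (simp add: infsumI)
qed

text \<open>The two ray sums interlace. Comparing them termwise at \<open>\<mu> = 3 * a / u\<close>, and again at \<open>\<mu> = a / u\<close>
  after removing the leading term \<open>g a\<close>, gives opposite signs. The bound \<open>u \<le> 1/4\<close> makes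
  \<open>1 - u \<ge> 3 * u\<close>, so that at \<open>\<mu> = a / u\<close> only the leading argument falls below \<open>3 * a\<close>.\<close>

lemma lattice_sum_has_zero:
  assumes odd: "\<And>y. g (- y) = - g y" and cont: "continuous_on UNIV g"
    and decay: "\<And>y. \<bar>g y\<bar> \<le> C * exp (- \<bar>y\<bar>)"
    and a: "0 < a" "g a \<le> 0"
    and anti: "\<And>s t. 3 * a \<le> s \<Longrightarrow> s \<le> t \<Longrightarrow> g t \<le> g s"
    and u: "0 < u" "u \<le> 1 / 4"
  shows "\<exists>\<mu>>0. lattice_sum g \<mu> u = 0"
proof -
  define A where "A c \<mu> = (\<Sum>j. g (\<mu> * (c + real j)))" for c \<mu>
  have split: "lattice_sum g \<mu> u = A u \<mu> - A (1 - u) \<mu>" if "0 < \<mu>" for \<mu>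
    unfolding A_def using u that by (intro lattice_sum_eq_ray_sums[OF odd decay]) auto
  have sm: "summable (\<lambda>j. g (\<mu> * (c + real j)))" if "0 < \<mu>" "0 \<le> c" for \<mu> c
    using ray_summable[OF decay that] by (rule summable_norm_cancel)
  have au: "0 < a / u" using a u by simp

  have low: "A u (a / u) - A (1 - u) (a / u) \<le> 0"
  proof -
    have "A u (a / u) = g a + (\<Sum>j. g (a / u * (u + real (Suc j))))"
      unfolding A_def using suminf_split_head[OF sm[OF au, of u]] u by (simp add: field_simps)
    also have "(\<Sum>j. g (a / u * (u + real (Suc j)))) \<le> A (1 - u) (a / u)"
      unfolding A_def
    proof (rule suminf_le)
      fix j
      have "3 * u \<le> 1 - u + real j" using u by simp
      then have "a / u * (3 * u) \<le> a / u * (1 - u + real j)"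
        using au by (intro mult_left_mono) auto
      moreover have "a / u * (1 - u + real j) \<le> a / u * (u + real (Suc j))"
        using au u by (intro mult_left_mono) auto
      ultimately show "g (a / u * (u + real (Suc j))) \<le> g (a / u * (1 - u + real j))"
        using u by (intro anti) auto
    next
      show "summable (\<lambda>j. g (a / u * (u + real (Suc j))))"
        using sm[OF au, of u] u by (subst summable_Suc_iff) auto
    qed (use sm[OF au, of "1 - u"] u in auto)
    finally show ?thesis using a by simp
  qed

  have high: "0 \<le> A u (3 * (a / u)) - A (1 - u) (3 * (a / u))"
  proof -
    have "A (1 - u) (3 * (a / u)) \<le> A u (3 * (a / u))"
      unfolding A_def
    proof (rule suminf_le)
      fix j
      have "3 * (a / u) * u \<le> 3 * (a / u) * (u + real j)"
        using au by (intro mult_left_mono) auto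
      moreover have "3 * (a / u) * (u + real j) \<le> 3 * (a / u) * (1 - u + real j)"
        using au u by (intro mult_left_mono) auto
      ultimately show "g (3 * (a / u) * (1 - u + real j)) \<le> g (3 * (a / u) * (u + real j))"
        using u by (intro anti) auto
    qed (use sm[of "3 * (a / u)"] au u in auto)
    then show ?thesis by simp
  qed

  have "continuous_on {a / u..3 * (a / u)} (\<lambda>\<mu>. A u \<mu> - A (1 - u) \<mu>)"
    unfolding A_def using u
    by (intro continuous_on_diff ray_sum_continuous[OF cont decay au]) auto
  then obtain \<mu> where "a / u \<le> \<mu>" "A u \<mu> - A (1 - u) \<mu> = 0"
    using IVT'[of "\<lambda>\<mu>. A u \<mu> - A (1 - u) \<mu>" "a / u" 0 "3 * (a / u)"] low high au by auto
  then show ?thesis using split[of \<mu>] au by (intro exI[of _ \<mu>]) auto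
qed

section \<open>Zeros of the Zak transform\<close>

text \<open>For a family that is not summable both sides are \<open>0\<close>, because summability of the complex family
  passes to its real part.\<close>

lemma infsum_complex_of_real:
  "(\<Sum>\<^sub>\<infinity>k\<in>K. complex_of_real (f k)) = of_real (\<Sum>\<^sub>\<infinity>k\<in>K. f k)"
proof (cases "f summable_on K")
  case True
  then show ?thesis by (intro infsumI has_sum_of_real has_sum_infsum)
next
  case False
  then have "\<not> (\<lambda>k. complex_of_real (f k)) summable_on K"
    using summable_on_Re by fastforce
  with False show ?thesis by (simp add: infsum_not_exists)
qed

lemma zak_of_real_int_freq:
  "zak lam (\<lambda>t. of_real (f t)) x (of_int l) = of_real (sqrt lam * lattice_sum f lam x)"
proof -
  have "exp (- 2 * pi * \<i> * of_int k * of_real (of_int l)) = 1" for k :: int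
    using exp_integer_2pi[of "of_int (- k * l)"] by (simp add: algebra_simps)
  then have "zak lam (\<lambda>t. of_real (f t)) x (of_int l) =
      of_real (sqrt lam) * (\<Sum>\<^sub>\<infinity>k::int. of_real (f (lam * (x + of_int k))))"
    unfolding zak_def by (simp only: mult_1_right)
  also have "(\<Sum>\<^sub>\<infinity>k::int. complex_of_real (f (lam * (x + of_int k)))) =
      of_real (lattice_sum f lam x)"
    unfolding lattice_sum_def by (rule infsum_complex_of_real)
  finally show ?thesis by simp
qed

lemma lattice_sum_hermite_fun:
  "lattice_sum (hermite_fun n) lam x =
     hermite_const n powr (- 1 / 2) * sqrt (2 * pi) ^ n *
     lattice_sum (hermite_gauss n) (sqrt (2 * pi) * lam) x"
  unfolding lattice_sum_def hermite_fun_eq_hermite_gauss by (simp add: infsum_cmult_right' mult.assoc)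

theorem lemma4p11:
  fixes n :: nat and x0 :: real
  assumes "n \<ge> 3" and "odd n"
    and "x0 \<in> {- 1 / 4 .. 1 / 4} + \<int>"
  shows "\<exists>lam > 0.
           zak lam (\<lambda>t. of_real (hermite_fun n t)) x0 0 = 0 \<and>
           (\<forall>k l :: int.
              zak lam (\<lambda>t. of_real (hermite_fun n t)) (x0 + of_int k) (of_int l) = 0 \<and>
              zak lam (\<lambda>t. of_real (hermite_fun n t)) (- x0 + of_int k) (of_int l) = 0)"
proof -
  let ?g = "hermite_gauss n"
  note refl = lattice_sum_minus[of ?g, OF hermite_gauss_minus[OF assms(2)]]
  obtain v m where v: "- 1 / 4 \<le> v" "v \<le> 1 / 4" and x0: "x0 = v + of_int m"
    using assms(3) by (auto simp: set_plus_def elim!: Ints_cases)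
  have zero_u: "\<exists>\<mu>>0. lattice_sum ?g \<mu> \<bar>v\<bar> = 0"
  proof (cases "v = 0")
    case True
    have "lattice_sum ?g 1 0 = 0" using refl[of 1 0] by simp
    with True show ?thesis by (intro exI[of _ 1]) auto
  next
    case False
    obtain C where C: "\<And>y. \<bar>?g y\<bar> \<le> C * exp (- \<bar>y\<bar>)"
      using hermite_gauss_exponential_decay by blast
    obtain a where a: "0 < a" "?g a = 0"
      and anti: "\<And>s t. 3 * a \<le> s \<Longrightarrow> s \<le> t \<Longrightarrow> ?g t \<le> ?g s"
      using hermite_gauss_root_antimono[OF assms(1)] by blast
    show ?thesis
      by (rule lattice_sum_has_zero[OF hermite_gauss_minus[OF assms(2)]
            continuous_on_hermite_gauss C a(1) _ anti])
         (use a v False in auto)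
  qed
  then obtain \<mu> where \<mu>: "0 < \<mu>" "lattice_sum ?g \<mu> \<bar>v\<bar> = 0" by blast
  have "lattice_sum ?g \<mu> v = 0"
    using \<mu>(2) refl[of \<mu> v] by (cases "0 \<le> v") auto
  then have "lattice_sum ?g \<mu> x0 = 0" by (simp add: x0 lattice_sum_shift)
  then have zero: "lattice_sum ?g \<mu> (x0 + of_int k) = 0"
    "lattice_sum ?g \<mu> (- x0 + of_int k) = 0" for k
    by (simp_all only: lattice_sum_shift refl[of \<mu> x0] minus_zero)
  define lam where "lam = \<mu> / sqrt (2 * pi)"
  have "0 < lam" and s: "sqrt (2 * pi) * lam = \<mu>"
    using \<mu>(1) by (auto simp: lam_def)
  have zak0: "zak lam (\<lambda>t. of_real (hermite_fun n t)) (x0 + of_int k) (of_int l) = 0 \<and>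
      zak lam (\<lambda>t. of_real (hermite_fun n t)) (- x0 + of_int k) (of_int l) = 0" for k l :: int
    by (simp only: zak_of_real_int_freq lattice_sum_hermite_fun s zero) simp
  show ?thesis
    using \<open>0 < lam\<close> zak0 zak0[of 0 0] by (intro exI[of _ lam]) simp
qed

end
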